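(* Let $n\ge 3$. Among non-degenerated convex $n$-gons, the equiangular $n$-gons can be characterized by one center function: there is an $n$-gon center function $f$ (on the domain of non-degenerated convex $n$-gons) such that a non-degenerated convex $n$-gon $(V_1,\ldots,V_n)$ is equiangular if and only if $$f(V_1,\ldots,V_n)=f(V_2,\ldots,V_n,V_1)=\ldots=f(V_n,V_1,\ldots,V_{n-1}).$$
   Context: An $n$-gon is identified with a tuple $(V_1,\ldots,V_n)$ of points of $\mathbb R^2$ (its labelled vertices), the edges being the segments $V_iV_{i+1}$ (indices mod $n$, taken in $\{1,\ldots,n\}$). It is non-degenerated if no two vertices coincide. It is convex if $V_i\ne V_j$ for $i\ne j$ and, for every $i$, all vertices except $V_i,V_{i+1}$ lie on the same side of the line through $V_i,V_{i+1}$. It is equiangular if all its angles at the vertices (between adjacent sides) are equal. Let $\sigma$ be the permutation of $\{1,\ldots,n\}$ given by $\sigma(i)=2+n-i\bmod n$ (so $\sigma(1)=1$). An $n$-gon center function is a real-valued function $f(V_1,\ldots,V_n)$ such that, for $n$-gons in its domain: (1) $f(V_1,V_2,\ldots,V_n)=f(V_1,V_{\sigma(2)},\ldots,V_{\sigma(n)})$; (2) there is $k\in\mathbb N$ (with $0\in\mathbb N$) such that $f(tV_1,\ldots,tV_n)=t^kf(V_1,\ldots,V_n)$ for all $t\in\mathbb R_{\ge 0}$ (for which $(tV_1,\ldots,tV_n)$ is in the domain); (3) $f(T(V_1),\ldots,T(V_n))=f(V_1,\ldots,V_n)$ for every rigid motion (isometry) $T$ of the plane. Center functions $f_1,\ldots,f_k$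 characterize a family $\mathcal F$ of $n$-gons if: $(V_1,\ldots,V_n)\in\mathcal F$ if and only if $f_l(V_1,\ldots,V_n)=f_l(V_2,\ldots,V_n,V_1)=\ldots=f_l(V_n,V_1,\ldots,V_{n-1})$ for every $l=1,\ldots,k$. *)

theory Defs
  imports "HOL-Analysis.Analysis"
begin

(* The tuple (V_1, ..., V_n) is a list V of length n; positions are counted from 0, so that
   V_i is V ! (i - 1), and (V_{l+1}, ..., V_n, V_1, ..., V_l) is rotate l V. *)
type_synonym polygon = "(real^2) list"

definition nondegenerate :: "polygon \<Rightarrow> bool" where
  "nondegenerate V \<longleftrightarrow> distinct V"

(* The two sides of a line are its two open half-planes, so points on the line are on neither
   side.  Replacing (a, b) by (-a, -b) exchanges the sides, so a single inequality suffices;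
   a is nonzero because a line is neither the empty set nor the plane. *)
definition on_same_side :: "(real^2) set \<Rightarrow> (real^2) set \<Rightarrow> bool" where
  "on_same_side L S \<longleftrightarrow> (\<exists>a b. L = {x. a \<bullet> x = b} \<and> (\<forall>x\<in>S. a \<bullet> x > b))"

definition convex_polygon :: "polygon \<Rightarrow> bool" where
  "convex_polygon V \<longleftrightarrow>
     (\<forall>i<length V. \<forall>j<length V. i \<noteq> j \<longrightarrow> V ! i \<noteq> V ! j) \<and>
     (\<forall>i<length V. let j = (i + 1) mod length V in
        on_same_side (affine hull {V ! i, V ! j}) {V ! k | k. k < length V \<and> k \<noteq> i \<and> k \<noteq> j})"

definition convex_ngons :: "nat \<Rightarrow> polygon set" where
  "convex_ngons n = {V. length V = n \<and> nondegenerate V \<and> convex_polygon V}"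

(* Measure in [0, pi] of the angle at B between the segments BA and BC. *)
definition angle_at :: "real^2 \<Rightarrow> real^2 \<Rightarrow> real^2 \<Rightarrow> real" where
  "angle_at A B C = arccos (((A - B) \<bullet> (C - B)) / (norm (A - B) * norm (C - B)))"

(* For a convex polygon the angle between the adjacent sides is the interior angle. *)
definition vertex_angle :: "polygon \<Rightarrow> nat \<Rightarrow> real" where
  "vertex_angle V i =
     angle_at (V ! ((i + length V - 1) mod length V)) (V ! i) (V ! ((i + 1) mod length V))"

definition equiangular :: "polygon \<Rightarrow> bool" where
  "equiangular V \<longleftrightarrow> (\<forall>i<length V. \<forall>j<length V. vertex_angle V i = vertex_angle V j)"

(* (V_{sigma 1}, ..., V_{sigma n}) for sigma i = 2 + n - i mod n.  In positions counted
   from 0, sigma is the map sending i to - i mod n; in particular it fixes position 0. *)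
definition reflect_labels :: "polygon \<Rightarrow> polygon" where
  "reflect_labels V = map (\<lambda>i. V ! ((length V - i) mod length V)) [0..<length V]"

(* f is a center function on the domain D; its values outside D are irrelevant as soon as D is
   closed under relabelling and isometries, as convex_ngons n is. *)
definition center_function :: "polygon set \<Rightarrow> (polygon \<Rightarrow> real) \<Rightarrow> bool" where
  "center_function D f \<longleftrightarrow>
     (\<forall>V\<in>D. f V = f (reflect_labels V)) \<and>
     (\<exists>k::nat. \<forall>V\<in>D. \<forall>t\<ge>0. map (\<lambda>v. t *\<^sub>R v) V \<in> D \<longrightarrow>
        f (map (\<lambda>v. t *\<^sub>R v) V) = t ^ k * f V) \<and>
     (\<forall>V\<in>D. \<forall>T. (\<forall>x y. dist (T x) (T y) = dist x y) \<longrightarrow> f (map T V) = f V)"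

(* The center functions in fs characterize the family F among the polygons in D. *)
definition characterize ::
  "polygon set \<Rightarrow> (polygon \<Rightarrow> real) set \<Rightarrow> polygon set \<Rightarrow> bool" where
  "characterize D fs F \<longleftrightarrow>
     (\<forall>V\<in>D. V \<in> F \<longleftrightarrow> (\<forall>f\<in>fs. \<forall>l<length V. f (rotate l V) = f V))"

end

theory Submission
  imports Defs
begin

text \<open>The vertex angle at \<open>V\<^sub>1\<close> is itself a center function, homogeneous of degree 0, and its
  values on the cyclic shifts of a polygon are exactly the angles of the polygon.\<close>

lemma angle_at_commute: "angle_at A B C = angle_at C B A"
  by (simp add: angle_at_def inner_commute mult.commute)

text \<open>The inner product and the product of the norms both acquire the factor t^2, which
  cancels because t is nonzero.\<close>

lemma angle_at_scaleR:
  assumes "t > 0"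
  shows "angle_at (t *\<^sub>R A) (t *\<^sub>R B) (t *\<^sub>R C) = angle_at A B C"
  using assms
  by (simp add: angle_at_def flip: scaleR_diff_right)

text \<open>By polarization (the law of cosines) the inner product, and with it the angle, is
  determined by the three mutual distances.\<close>

lemma angle_at_isometry:
  assumes "\<And>x y. dist (T x) (T y) = dist x y"
  shows "angle_at (T A) (T B) (T C) = angle_at A B C"
proof -
  have polarization: "(P - Q) \<bullet> (R - Q) = ((dist P Q)\<^sup>2 + (dist R Q)\<^sup>2 - (dist P R)\<^sup>2) / 2"
    for P Q R :: "real^2"
    by (simp add: dist_norm power2_norm_eq_inner algebra_simps inner_commute)
  show ?thesis
    unfolding angle_at_def polarization using assms by (simp add: dist_norm)
qed

text \<open>Shifting by \<open>l\<close> brings vertex \<open>l\<close> to position 0 and keeps its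
  cyclic neighbours next to it.\<close>

lemma vertex_angle_rotate:
  assumes "l < length V"
  shows "vertex_angle (rotate l V) 0 = vertex_angle V l"
proof -
  \<comment> \<open>Makes the neighbour indices, reduced mod \<open>length V\<close>, valid list
    positions, as \<open>nth_rotate\<close> requires.\<close>
  have "0 < length V"
    using assms by linarith
  then show ?thesis
    using assms by (simp add: vertex_angle_def nth_rotate mod_add_right_eq)
qed

text \<open>The relabelling fixes position 0 and exchanges its neighbours, positions 1 and
  \<open>length V - 1\<close>; the angle is symmetric in its two arms.\<close>

lemma vertex_angle_reflect_labels:
  assumes "2 \<le> length V"
  shows "vertex_angle (reflect_labels V) 0 = vertex_angle V 0"
proof -
  have len: "length (reflect_labels V) = length V"
    by (simp add: reflect_labels_def)
  have nth: "reflect_labels V ! i = V ! ((length V - i) mod length V)" if "i < length V" for i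
    using that by (simp add: reflect_labels_def)
  have "length V - 1 < length V" "1 < length V" "0 < length V" "length V - (length V - 1) = 1"
    using assms by linarith+
  then show ?thesis
    by (simp add: vertex_angle_def len nth angle_at_commute)
qed

lemma vertex_angle_map_scaleR:
  assumes "t > 0" "i < length V"
  shows "vertex_angle (map (\<lambda>v. t *\<^sub>R v) V) i = vertex_angle V i"
proof -
  have "0 < length V"
    using assms by linarith
  then show ?thesis
    using assms by (simp add: vertex_angle_def angle_at_scaleR)
qed

lemma vertex_angle_map_isometry:
  assumes "\<And>x y. dist (T x) (T y) = dist x y" "i < length V"
  shows "vertex_angle (map T V) i = vertex_angle V i"
proof -
  have "0 < length V"
    using assms(2) by linarith
  then show ?thesis
    using assms by (simp add: vertex_angle_def angle_at_isometry)
qed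

text \<open>Serves to exclude the scaling factor 0, which collapses all vertices to the
  origin.\<close>

lemma not_distinct_map_const:
  assumes "2 \<le> length xs"
  shows "\<not> distinct (map (\<lambda>_. c) xs)"
proof -
  have "0 < length xs" "1 < length xs"
    using assms by linarith+
  then show ?thesis
    by (metis distinct_conv_nth length_map nth_map zero_neq_one)
qed

text \<open>All angles agree as soon as each equals the one at position 0; for the empty list both
  sides hold vacuously.\<close>

lemma equiangular_iff_rotate:
  "equiangular V \<longleftrightarrow> (\<forall>l<length V. vertex_angle (rotate l V) 0 = vertex_angle V 0)"
proof -
  have "equiangular V \<longleftrightarrow> (\<forall>l<length V. vertex_angle V l = vertex_angle V 0)"
    unfolding equiangular_def by (metis gr_zeroI not_less_zero)
  then show ?thesis
    by (simp add: vertex_angle_rotate)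
qed

theorem theorem19:
  fixes n :: nat
  assumes "n \<ge> 3"
  shows "\<exists>f. center_function (convex_ngons n) f \<and>
             characterize (convex_ngons n) {f} {V. equiangular V}"
proof (intro exI conjI)
  let ?f = "\<lambda>V. vertex_angle V 0"
  have len: "length V \<ge> 3" if "V \<in> convex_ngons n" for V
    using that assms by (simp add: convex_ngons_def)
  \<comment> \<open>The factor \<open>t ^ 0\<close> is kept explicit so that the degree
    \<open>k = 0\<close> can be read off as the witness in \<open>center_function\<close>.\<close>
  have "?f (map (\<lambda>v. t *\<^sub>R v) V) = t ^ 0 * ?f V"
    if V: "V \<in> convex_ngons n" and t: "t \<ge> 0" and tV: "map (\<lambda>v. t *\<^sub>R v) V \<in> convex_ngons n"
    for V t
  proof -
    have "distinct (map (\<lambda>v. t *\<^sub>R v) V)"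
      using tV by (simp add: convex_ngons_def nondegenerate_def)
    moreover have "\<not> distinct (map (\<lambda>v. 0 *\<^sub>R v) V)"
      using len[OF V] not_distinct_map_const[of V] by simp
    ultimately have "t \<noteq> 0"
      by blast
    moreover have "0 < length V"
      using len[OF V] by linarith
    ultimately show ?thesis
      using t by (simp add: vertex_angle_map_scaleR)
  qed
  moreover have "?f V = ?f (reflect_labels V)" if "V \<in> convex_ngons n" for V
    using len[OF that] by (simp add: vertex_angle_reflect_labels)
  moreover have "?f (map T V) = ?f V"
    if "V \<in> convex_ngons n" "\<forall>x y. dist (T x) (T y) = dist x y" for V T
  proof (rule vertex_angle_map_isometry)
    show "0 < length V"
      using len[OF that(1)] by linarith
  qed (use that(2) in blast)
  ultimately show "center_function (convex_ngons n) ?f"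
    unfolding center_function_def by blast
  show "characterize (convex_ngons n) {?f} {V. equiangular V}"
    by (simp add: characterize_def equiangular_iff_rotate)
qed

end
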